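(* Let $T>0$ and let $(X_t)_{t\ge0}$ be an $L^2$-continuous free Poisson process in a $W^*$-probability space $(\mathcal{A},\varphi)$ with distribution $\kappa_n(X_t)=t\alpha^n$, $t\ge0$, $n=1,2,\dots$, for some $\alpha\in\mathbb{R}$. Let $$\widetilde{X}_t=X_t-t\alpha I\ (t\ge0),\qquad \lambda_n=\frac{\alpha^2T^2}{(n-1/2)^2\pi^2},\qquad \phi_n(t)=\Bigl(\frac{2}{T}\Bigr)^{1/2}\sin\Bigl(\frac{(n-1/2)\pi t}{T}\Bigr),\quad n\ge1,$$ where $I$ is the unit of $\mathcal{A}$, and let $Z_i=\int_0^T\widetilde{X}_t\,\phi_i(t)\,dt$ for $i\ge1$. Then: (1) $\widetilde{X}_t=\sum_{i=1}^\infty Z_i\,\phi_i(t)$ for $0<t\le T$, where the convergence is in $L^2(\mathcal{A},\varphi)$; (2) $\varphi(Z_iZ_j)=\delta_{i,j}\lambda_i$ for all $i,j$.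
   Context: A $W^*$-probability space $(\mathcal{A},\varphi)$ is a finite von Neumann algebra with a faithful normal tracial state; $\|a\|_2=\varphi(a^*a)^{1/2}$ and $L^2(\mathcal{A},\varphi)$ is the completion of $\mathcal{A}$ in $\|\cdot\|_2$ (the product $\varphi(Z_iZ_j)$ of elements of $L^2$ is understood by continuous extension). $L^2$-continuous means $t\mapsto X_t$ is continuous for $\|\cdot\|_2$; the integrals $Z_i$ are integrals of $\|\cdot\|_2$-continuous $L^2(\mathcal{A},\varphi)$-valued functions. $\kappa_n$ are the usual free cumulants and $\kappa_n(a):=\kappa_n(a,\dots,a)$. Free Poisson process (with $k=1$ and parameter $\alpha\in\mathbb{R}$): a family $\{X_t:t\ge0\}$ of self-adjoint elements such that (1) $X_0=0$; (2) for $0\le t_1<\cdots<t_n<\infty$, the increments $X_{t_n}-X_{t_{n-1}},\dots,X_{t_2}-X_{t_1}$ are freely independent; (3) for $0\le s<t$, $\kappa_n(X_t-X_s)=(t-s)\alpha^n$ for all $n\ge1$. *)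

theory Defs
  imports "HOL-Analysis.Analysis"
begin

section \<open>Complex Hilbert spaces\<close>

class complex_vector = real_vector +
  fixes scaleC :: "complex \<Rightarrow> 'a \<Rightarrow> 'a"  (infixr \<open>*\<^sub>C\<close> 75)
  assumes scaleC_add_right: "c *\<^sub>C (x + y) = c *\<^sub>C x + c *\<^sub>C y"
    and scaleC_add_left: "(c + d) *\<^sub>C x = c *\<^sub>C x + d *\<^sub>C x"
    and scaleC_scaleC: "c *\<^sub>C (d *\<^sub>C x) = (c * d) *\<^sub>C x"
    and scaleC_of_real: "complex_of_real r *\<^sub>C x = r *\<^sub>R x"

class complex_normed_vector = complex_vector + real_normed_vector +
  assumes norm_scaleC: "norm (c *\<^sub>C x) = cmod c * norm x"

text \<open>The inner product is linear in its second and conjugate-linear in its first argument.\<close>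

class complex_inner = complex_normed_vector +
  fixes cinner :: "'a \<Rightarrow> 'a \<Rightarrow> complex"
  assumes cinner_commute: "cinner x y = cnj (cinner y x)"
    and cinner_add_right: "cinner x (y + z) = cinner x y + cinner x z"
    and cinner_scaleC_right: "cinner x (c *\<^sub>C y) = c * cinner x y"
    and cinner_self: "cinner x x = complex_of_real ((norm x)\<^sup>2)"

class chilbert_space = complex_inner + banach

section \<open>Bounded operators\<close>

text \<open>
  Operators are real-bounded-linear maps (the library type); the complex-linear ones are singled
  out by \<open>clinear_op\<close>.
\<close>

type_synonym 'h op = "'h \<Rightarrow>\<^sub>L 'h"

instantiation blinfun :: (real_normed_vector, complex_normed_vector) complex_vector
begin

definition scaleC_blinfun :: "complex \<Rightarrow> ('a \<Rightarrow>\<^sub>L 'b) \<Rightarrow> ('a \<Rightarrow>\<^sub>L 'b)" where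
  "scaleC_blinfun c f = Blinfun (\<lambda>x. c *\<^sub>C blinfun_apply f x)"

lemma blinfun_apply_scaleC:
  "blinfun_apply (c *\<^sub>C f) x = c *\<^sub>C blinfun_apply f x"
  for f :: "'a \<Rightarrow>\<^sub>L 'b"
proof -
  have "bounded_linear (\<lambda>x. c *\<^sub>C blinfun_apply f x)"
  proof (rule bounded_linear_intro)
    show "c *\<^sub>C blinfun_apply f (x + y) = c *\<^sub>C blinfun_apply f x + c *\<^sub>C blinfun_apply f y" for x y
      by (simp add: blinfun.add_right scaleC_add_right)
    show "c *\<^sub>C blinfun_apply f (r *\<^sub>R x) = r *\<^sub>R (c *\<^sub>C blinfun_apply f x)" for r x
      by (simp add: blinfun.scaleR_right mult.commute scaleC_scaleC flip: scaleC_of_real)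
    show "norm (c *\<^sub>C blinfun_apply f x) \<le> norm x * (cmod c * norm f)" for x
      using mult_left_mono[OF norm_blinfun[of f x], of "cmod c"]
      by (simp add: norm_scaleC algebra_simps)
  qed
  then show ?thesis
    by (simp add: scaleC_blinfun_def bounded_linear_Blinfun_apply)
qed

instance
  by standard
    (auto intro!: blinfun_eqI simp: blinfun_apply_scaleC blinfun.add_left blinfun.scaleR_left
      scaleC_add_right scaleC_add_left scaleC_scaleC scaleC_of_real)

end

definition clinear_op :: "'h::complex_normed_vector op \<Rightarrow> bool" where
  "clinear_op a \<longleftrightarrow> (\<forall>c x. blinfun_apply a (c *\<^sub>C x) = c *\<^sub>C blinfun_apply a x)"

definition is_adjoint :: "'h::complex_inner op \<Rightarrow> 'h op \<Rightarrow> bool" where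
  "is_adjoint b a \<longleftrightarrow>
     (\<forall>x y. cinner (blinfun_apply b x) y = cinner x (blinfun_apply a y))"

definition adj :: "'h::complex_inner op \<Rightarrow> 'h op" where
  "adj a = (THE b. is_adjoint b a)"

abbreviation selfadjoint :: "'h::complex_inner op \<Rightarrow> bool" where
  "selfadjoint a \<equiv> is_adjoint a a"

definition op_le :: "'h::complex_inner op \<Rightarrow> 'h op \<Rightarrow> bool" where
  "op_le a b \<longleftrightarrow> (\<forall>x. cinner x (blinfun_apply (b - a) x) \<in> \<real>\<^sub>\<ge>\<^sub>0)"

definition op_prod :: "'h::real_normed_vector op list \<Rightarrow> 'h op" where
  "op_prod xs = foldr (o\<^sub>L) xs id_blinfun"

section \<open>Von Neumann algebras and normal tracial states\<close>

definition unital_star_algebra :: "'h::complex_inner op set \<Rightarrow> bool" where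
  "unital_star_algebra A \<longleftrightarrow>
     (\<forall>a\<in>A. clinear_op a) \<and> id_blinfun \<in> A \<and>
     (\<forall>a\<in>A. \<forall>b\<in>A. a + b \<in> A) \<and>
     (\<forall>c. \<forall>a\<in>A. c *\<^sub>C a \<in> A) \<and>
     (\<forall>a\<in>A. \<forall>b\<in>A. a o\<^sub>L b \<in> A) \<and>
     (\<forall>a\<in>A. \<exists>b\<in>A. is_adjoint b a)"

definition commutant :: "'h::complex_normed_vector op set \<Rightarrow> 'h op set" where
  "commutant A = {b. clinear_op b \<and> (\<forall>a\<in>A. a o\<^sub>L b = b o\<^sub>L a)}"

definition von_neumann_algebra :: "'h::chilbert_space op set \<Rightarrow> bool" where
  "von_neumann_algebra A \<longleftrightarrow> unital_star_algebra A \<and> commutant (commutant A) = A"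

text \<open>Finite: every isometry in the algebra is unitary.\<close>

definition finite_algebra :: "'h::chilbert_space op set \<Rightarrow> bool" where
  "finite_algebra A \<longleftrightarrow>
     (\<forall>v\<in>A. adj v o\<^sub>L v = id_blinfun \<longrightarrow> v o\<^sub>L adj v = id_blinfun)"

definition state_on :: "'h::chilbert_space op set \<Rightarrow> ('h op \<Rightarrow> complex) \<Rightarrow> bool" where
  "state_on A \<phi> \<longleftrightarrow>
     (\<forall>a\<in>A. \<forall>b\<in>A. \<phi> (a + b) = \<phi> a + \<phi> b) \<and>
     (\<forall>c. \<forall>a\<in>A. \<phi> (c *\<^sub>C a) = c * \<phi> a) \<and>
     (\<forall>a\<in>A. \<phi> (adj a o\<^sub>L a) \<in> \<real>\<^sub>\<ge>\<^sub>0) \<and>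
     \<phi> id_blinfun = 1"

definition faithful_on :: "'h::chilbert_space op set \<Rightarrow> ('h op \<Rightarrow> complex) \<Rightarrow> bool" where
  "faithful_on A \<phi> \<longleftrightarrow> (\<forall>a\<in>A. \<phi> (adj a o\<^sub>L a) = 0 \<longrightarrow> a = 0)"

definition tracial_on :: "'h::chilbert_space op set \<Rightarrow> ('h op \<Rightarrow> complex) \<Rightarrow> bool" where
  "tracial_on A \<phi> \<longleftrightarrow> (\<forall>a\<in>A. \<forall>b\<in>A. \<phi> (a o\<^sub>L b) = \<phi> (b o\<^sub>L a))"

text \<open>
  Normal: the state preserves suprema of upward directed sets of self-adjoint elements that have a
  supremum \<open>s\<close> in the algebra. The set of real numbers below is bounded by \<open>Re (\<phi> s)\<close>, so that
  its \<open>SUP\<close> is a genuine supremum.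
\<close>

definition normal_on :: "'h::chilbert_space op set \<Rightarrow> ('h op \<Rightarrow> complex) \<Rightarrow> bool" where
  "normal_on A \<phi> \<longleftrightarrow>
     (\<forall>D s. D \<noteq> {} \<and> D \<subseteq> {a \<in> A. selfadjoint a} \<and>
        (\<forall>a\<in>D. \<forall>b\<in>D. \<exists>c\<in>D. op_le a c \<and> op_le b c) \<and>
        s \<in> A \<and> selfadjoint s \<and> (\<forall>a\<in>D. op_le a s) \<and>
        (\<forall>u\<in>A. selfadjoint u \<and> (\<forall>a\<in>D. op_le a u) \<longrightarrow> op_le s u)
      \<longrightarrow> Re (\<phi> s) = (SUP a\<in>D. Re (\<phi> a)))"

definition wstar_prob_space :: "'h::chilbert_space op set \<Rightarrow> ('h op \<Rightarrow> complex) \<Rightarrow> bool" where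
  "wstar_prob_space A \<phi> \<longleftrightarrow>
     von_neumann_algebra A \<and> finite_algebra A \<and>
     state_on A \<phi> \<and> faithful_on A \<phi> \<and> normal_on A \<phi> \<and> tracial_on A \<phi>"

section \<open>The completion in the 2-norm\<close>

definition norm2 :: "('h::chilbert_space op \<Rightarrow> complex) \<Rightarrow> 'h op \<Rightarrow> real" where
  "norm2 \<phi> a = sqrt (Re (\<phi> (adj a o\<^sub>L a)))"

text \<open>
  A completion of \<open>A\<close> for the 2-norm, given by its canonical embedding \<open>\<iota>\<close> into a complete space:
  \<open>\<iota>\<close> is complex-linear and isometric with dense range. Only the values of \<open>\<iota>\<close> on \<open>A\<close> matter.
\<close>

definition L2_completion ::
  "'h::chilbert_space op set \<Rightarrow> ('h op \<Rightarrow> complex) \<Rightarrow> ('h op \<Rightarrow> 'l::chilbert_space) \<Rightarrow> bool" where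
  "L2_completion A \<phi> \<iota> \<longleftrightarrow>
     (\<forall>a\<in>A. \<forall>b\<in>A. \<iota> (a + b) = \<iota> a + \<iota> b) \<and>
     (\<forall>c. \<forall>a\<in>A. \<iota> (c *\<^sub>C a) = c *\<^sub>C \<iota> a) \<and>
     (\<forall>a\<in>A. norm (\<iota> a) = norm2 \<phi> a) \<and>
     closure (\<iota> ` A) = UNIV"

text \<open>
  The continuous extension of \<open>(a, b) \<mapsto> \<phi> (a b)\<close> from \<open>A \<times> A\<close> to the completion.
\<close>

definition phi_mult ::
  "'h::chilbert_space op set \<Rightarrow> ('h op \<Rightarrow> complex) \<Rightarrow> ('h op \<Rightarrow> 'l::chilbert_space) \<Rightarrow>
   'l \<Rightarrow> 'l \<Rightarrow> complex" where
  "phi_mult A \<phi> \<iota> \<xi> \<eta> =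
     (THE c. \<forall>a b. (\<forall>n. a n \<in> A \<and> b n \<in> A) \<and>
        (\<lambda>n. \<iota> (a n)) \<longlonglongrightarrow> \<xi> \<and> (\<lambda>n. \<iota> (b n)) \<longlonglongrightarrow> \<eta> \<longrightarrow>
        (\<lambda>n. \<phi> (a n o\<^sub>L b n)) \<longlonglongrightarrow> c)"

section \<open>Free independence\<close>

definition generated_star_algebra :: "'h::complex_inner op set \<Rightarrow> 'h op set" where
  "generated_star_algebra S = \<Inter>{B. unital_star_algebra B \<and> S \<subseteq> B}"

text \<open>
  Freeness of a family of subalgebras: alternating products of centred elements are centred.
\<close>

definition free_subalgebras ::
  "('h::chilbert_space op \<Rightarrow> complex) \<Rightarrow> 'i set \<Rightarrow> ('i \<Rightarrow> 'h op set) \<Rightarrow> bool" where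
  "free_subalgebras \<phi> I B \<longleftrightarrow>
     (\<forall>js xs. js \<noteq> [] \<and> distinct_adj js \<and>
        list_all2 (\<lambda>j x. j \<in> I \<and> x \<in> B j \<and> \<phi> x = 0) js xs
      \<longrightarrow> \<phi> (op_prod xs) = 0)"

definition freely_independent ::
  "('h::chilbert_space op \<Rightarrow> complex) \<Rightarrow> 'i set \<Rightarrow> ('i \<Rightarrow> 'h op) \<Rightarrow> bool" where
  "freely_independent \<phi> I a \<longleftrightarrow>
     free_subalgebras \<phi> I (\<lambda>i. generated_star_algebra {a i})"

section \<open>Free cumulants\<close>

definition noncrossing :: "nat set set \<Rightarrow> bool" where
  "noncrossing P \<longleftrightarrow>
     (\<forall>V\<in>P. \<forall>W\<in>P. \<forall>a b c d. a < b \<and> b < c \<and> c < d \<and> a \<in> V \<and> c \<in> V \<and> b \<in> W \<and> d \<in> W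
        \<longrightarrow> V = W)"

definition NC :: "nat \<Rightarrow> nat set set set" where
  "NC n = {P. partition_on {..<n} P \<and> noncrossing P}"

lemma NC_proper_block:
  assumes "P \<in> NC n - {{{..<n}}}" "V \<in> P"
  shows "V \<subset> {..<n}"
proof -
  have P: "\<Union>P = {..<n}" "disjoint P" "{} \<notin> P" and ne: "P \<noteq> {{..<n}}"
    using assms(1) by (auto simp: NC_def partition_on_def)
  have "V \<noteq> {..<n}"
  proof
    assume V: "V = {..<n}"
    have "W = V" if "W \<in> P" for W
    proof (rule ccontr)
      assume "W \<noteq> V"
      with P(2) that assms(2) have "W \<inter> V = {}" by (auto dest: disjointD)
      moreover have "W \<subseteq> V" using P(1) that V by blast
      ultimately show False using P(3) that by (metis Int_absorb2)
    qed
    with assms(2) V ne show False by blast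
  qed
  with P(1) assms(2) show ?thesis by blast
qed

text \<open>
  The moment-cumulant formula, the sum over all noncrossing partitions \<open>P\<close> of the products of
  \<open>\<kappa>\<^bsub>|V|\<^esub>\<close> over the blocks \<open>V\<close> of \<open>P\<close> being \<open>\<phi> (x\<^sub>1 \<dots> x\<^sub>n)\<close>, solved for the term of the
  one-block partition. \<open>nths xs V\<close> lists the entries of \<open>xs\<close> in the positions \<open>V\<close>, in order.
\<close>

function free_cumulant :: "('h::chilbert_space op \<Rightarrow> complex) \<Rightarrow> 'h op list \<Rightarrow> complex" where
  "free_cumulant \<phi> xs =
     \<phi> (op_prod xs) -
     (\<Sum>P \<in> NC (length xs) - {{{..<length xs}}}. \<Prod>V\<in>P. free_cumulant \<phi> (nths xs V))"
  by pat_completeness auto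

termination
proof (relation "Wellfounded.measure (\<lambda>(\<phi>, xs). length xs)")
  fix \<phi> :: "'h op \<Rightarrow> complex" and xs :: "'h op list" and P :: "nat set set" and V :: "nat set"
  assume "P \<in> NC (length xs) - {{{..<length xs}}}" "V \<in> P"
  then have V: "V \<subset> {..<length xs}" by (rule NC_proper_block)
  then have "{i. i < length xs \<and> i \<in> V} = V" by auto
  moreover have "card V < length xs"
    using psubset_card_mono[OF finite_lessThan V] by simp
  ultimately show "((\<phi>, nths xs V), (\<phi>, xs)) \<in> Wellfounded.measure (\<lambda>(\<phi>, xs). length xs)"
    by (simp add: length_nths)
qed simp

declare free_cumulant.simps [simp del]

abbreviation free_cumulant1 ::
  "('h::chilbert_space op \<Rightarrow> complex) \<Rightarrow> nat \<Rightarrow> 'h op \<Rightarrow> complex" where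
  "free_cumulant1 \<phi> n a \<equiv> free_cumulant \<phi> (replicate n a)"

section \<open>Free Poisson processes\<close>

text \<open>The time index ranges over all reals; only nonnegative times are constrained.\<close>

definition free_poisson_process ::
  "'h::chilbert_space op set \<Rightarrow> ('h op \<Rightarrow> complex) \<Rightarrow> real \<Rightarrow> (real \<Rightarrow> 'h op) \<Rightarrow> bool" where
  "free_poisson_process A \<phi> \<alpha> X \<longleftrightarrow>
     (\<forall>t\<ge>0. X t \<in> A \<and> selfadjoint (X t)) \<and>
     X 0 = 0 \<and>
     (\<forall>ts. sorted_wrt (<) ts \<and> (\<forall>t\<in>set ts. 0 \<le> t) \<longrightarrow>
        freely_independent \<phi> {i. Suc i < length ts} (\<lambda>i. X (ts ! Suc i) - X (ts ! i))) \<and>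
     (\<forall>s t. 0 \<le> s \<and> s < t \<longrightarrow>
        (\<forall>n\<ge>1. free_cumulant1 \<phi> n (X t - X s) = complex_of_real ((t - s) * \<alpha> ^ n)))"

end

theory Submission
  imports Defs
begin

text \<open>
  The expansion is the Karhunen-Loeve expansion of Brownian motion in disguise. It depends on the
  process only through its covariance. Write \<open>f t\<close> for the image of the centred variable
  \<open>X t - t\<alpha>\<close> in \<open>L\<^sup>2\<close>. For \<open>s \<le> t\<close>, freeness of \<open>X s\<close> and \<open>X t - X s\<close> makes the centred
  increments orthogonal, and \<open>\<kappa>\<^sub>2 (X s) = s\<alpha>\<^sup>2\<close>, so that \<open>\<langle>f s, f t\<rangle> = \<alpha>\<^sup>2 min s t\<close>
  (\<open>free_poisson_covariance\<close>).

  The sine functions \<open>e\<^sub>k\<close> of the expansion are orthonormal eigenfunctions on \<open>[0, T]\<close> of the integral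
  operator with kernel \<open>\<alpha>\<^sup>2 min s t\<close>, for the eigenvalues \<open>\<lambda>\<^sub>k = \<alpha>\<^sup>2 / w\<^sub>k\<^sup>2\<close>, where \<open>w\<^sub>k\<close> is the
  frequency of \<open>e\<^sub>k\<close>. Moving inner products under the integral gives \<open>\<langle>Z\<^sub>k, f t\<rangle> = \<lambda>\<^sub>k e\<^sub>k(t)\<close> and
  \<open>\<langle>Z\<^sub>j, Z\<^sub>k\<rangle> = \<delta>\<^sub>j\<^sub>k \<lambda>\<^sub>k\<close>. Hence the partial sums of the expansion leave a remainder whose
  squared norm is \<open>\<alpha>\<^sup>2 t - (\<lambda>\<^sub>0 e\<^sub>0(t)\<^sup>2 + \<dots> + \<lambda>\<^sub>n e\<^sub>n(t)\<^sup>2)\<close>.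

  It tends to zero because of the diagonal case of Mercer's theorem for this kernel, which is
  an explicit series of squared sines. The double-angle formula turns it into the cosine series of
  the function \<open>x \<mapsto> x\<close> on \<open>[0, \<pi>]\<close> (\<open>odd_cosine_series\<close>), which is summed by showing that the
  termwise derivative converges, locally uniformly on \<open>(0, \<pi>)\<close>, to a constant.

  The remaining point is that the statement speaks of the extension of \<open>(a, b) \<mapsto> \<phi> (a b)\<close> rather
  than of the inner product, the extension of \<open>(a, b) \<mapsto> \<phi> (a\<^sup>* b)\<close>. The two agree if the left
  argument is self-adjoint in \<open>L\<^sup>2\<close> (\<open>phi_mult_eq_cinner\<close>), a property that integrals of
  self-adjoint elements inherit (\<open>L2_selfadjoint_integral\<close>).
\<close>

section \<open>The cosine series of the identity function\<close>

lemma sum_cos_odd_multiples: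
  "(\<Sum>k<N. 2 * cos (real (2 * k + 1) * x)) * sin x = sin (2 * real N * x)"
proof (induction N)
  case (Suc N)
  have "sin (2 * real (Suc N) * x) - sin (2 * real N * x) = 2 * cos (real (2 * N + 1) * x) * sin x"
    using sin_add[of "real (2 * N + 1) * x" x] sin_diff[of "real (2 * N + 1) * x" x]
    by (simp add: algebra_simps)
  with Suc show ?case
    by (simp add: algebra_simps)
qed simp

lemma sin_lower_bound:
  assumes "0 < a" "a \<le> u" "u \<le> pi - a"
  shows "sin a \<le> sin u"
proof (cases "u \<le> pi / 2")
  case True
  with assms show ?thesis by (intro sin_monotone_2pi_le) auto
next
  case False
  then have "sin a \<le> sin (pi - u)"
    using assms by (intro sin_monotone_2pi_le) auto
  then show ?thesis by simp
qed

text \<open>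
  Away from \<open>0\<close> and \<open>\<pi>\<close> the partial sums \<open>s\<close> of the sine series are constant up to an error of order
  \<open>1/N\<close>. Their derivative is \<open>sin (2 N u) / sin u\<close>, and adding the small function
  \<open>cos (2 N u) / (2 N sin u)\<close> cancels it up to a term of order \<open>1/N\<close>; this is an integration by
  parts carried out with the mean value inequality.
\<close>

lemma odd_sine_sum_oscillation:
  fixes a :: real and N :: nat
  assumes a: "0 < a" "a < pi / 2" and N: "N > 0"
    and x: "x \<in> {a..pi - a}"
  defines "s \<equiv> (\<lambda>u. \<Sum>k<N. 2 * sin (real (2 * k + 1) * u) / real (2 * k + 1))"
  shows "\<bar>s x - s (pi / 2)\<bar> \<le> (pi + 2) / (2 * (sin a)\<^sup>2) / real N"
proof -
  define m where "m = sin a"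
  have m: "0 < m" "m \<le> 1"
    using a by (auto simp: m_def intro!: sin_gt_zero)
  define r where "r = (\<lambda>u. cos (2 * real N * u) / (2 * real N * sin u))"
  define r' where "r' = (\<lambda>u. - (cos (2 * real N * u) * cos u / (2 * real N * (sin u)\<^sup>2)))"
  have sin_ge: "m \<le> sin u" if "u \<in> {a..pi - a}" for u
    using that a by (auto simp: m_def intro!: sin_lower_bound)
  have s': "(s has_real_derivative sin (2 * real N * u) / sin u) (at u)" if "sin u \<noteq> 0" for u
  proof -
    have "(s has_real_derivative (\<Sum>k<N. 2 * cos (real (2 * k + 1) * u))) (at u)"
      unfolding s_def by (rule derivative_eq_intros refl | simp add: mult.commute)+
    moreover have "(\<Sum>k<N. 2 * cos (real (2 * k + 1) * u)) = sin (2 * real N * u) / sin u"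
      by (rule eq_divide_imp[OF that sum_cos_odd_multiples])
    ultimately show ?thesis by (simp only:)
  qed
  have sr': "((\<lambda>u. s u + r u) has_real_derivative r' u) (at u within {a..pi - a})"
    if u: "u \<in> {a..pi - a}" for u
  proof -
    have nz: "sin u \<noteq> 0" using sin_ge[OF u] m by auto
    have "(r has_real_derivative - (sin (2 * real N * u) / sin u) + r' u) (at u)"
    proof -
      define c where "c = 2 * real N"
      have c: "c \<noteq> 0" using N by (simp add: c_def)
      have "((\<lambda>u. cos (c * u) / (c * sin u)) has_real_derivative
          (- sin (c * u) * c * (c * sin u) - cos (c * u) * (c * cos u)) / (c * sin u * (c * sin u))) (at u)"
        using nz c by (auto intro!: derivative_eq_intros)
      also have "(- sin (c * u) * c * (c * sin u) - cos (c * u) * (c * cos u)) / (c * sin u * (c * sin u))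
          = - (sin (c * u) / sin u) + - (cos (c * u) * cos u / (c * (sin u)\<^sup>2))"
        using nz c by (simp add: divide_simps power2_eq_square) (simp add: algebra_simps)
      finally show ?thesis
        unfolding r_def r'_def c_def .
    qed
    from DERIV_add[OF s'[OF nz] this] have "((\<lambda>u. s u + r u) has_real_derivative r' u) (at u)"
      by simp
    then show ?thesis by (rule has_field_derivative_at_within)
  qed
  have cos_prod: "\<bar>cos p * cos q\<bar> \<le> 1" for p q :: real
    unfolding abs_mult by (intro mult_le_one) auto
  have r'_bound: "norm (r' u) \<le> 1 / (2 * real N * m\<^sup>2)" if "u \<in> {a..pi - a}" for u
  proof -
    have "m\<^sup>2 \<le> (sin u)\<^sup>2"
      using sin_ge[OF that] m by (intro power_mono) auto
    then have "\<bar>cos (2 * real N * u) * cos u\<bar> / (2 * real N * (sin u)\<^sup>2) \<le> 1 / (2 * real N * m\<^sup>2)"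
      using cos_prod N m by (intro frac_le) auto
    then show ?thesis by (simp add: r'_def abs_mult)
  qed
  have half: "pi / 2 \<in> {a..pi - a}" using a by auto
  have "norm ((s x + r x) - (s (pi / 2) + r (pi / 2))) \<le>
      1 / (2 * real N * m\<^sup>2) * norm (x - pi / 2)"
    by (rule field_differentiable_bound[OF _ sr' r'_bound]) (use x half in auto)
  also have "\<dots> \<le> 1 / (2 * real N * m\<^sup>2) * pi"
    using x a by (intro mult_left_mono) (auto simp: abs_if)
  finally have 1: "\<bar>(s x + r x) - (s (pi / 2) + r (pi / 2))\<bar> \<le> pi / (2 * real N * m\<^sup>2)"
    by simp
  have r_bound: "\<bar>r u\<bar> \<le> 1 / (2 * real N * m\<^sup>2)" if "u \<in> {a..pi - a}" for u
  proof -
    have "m\<^sup>2 \<le> m" using m by (simp add: power2_eq_square mult_left_le)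
    also have "m \<le> sin u" by (rule sin_ge[OF that])
    finally have "\<bar>cos (2 * real N * u)\<bar> / (2 * real N * sin u) \<le> 1 / (2 * real N * m\<^sup>2)"
      using N m by (intro frac_le) auto
    then show ?thesis using sin_ge[OF that] m by (simp add: r_def abs_mult)
  qed
  have "\<bar>s x - s (pi / 2)\<bar> \<le> pi / (2 * real N * m\<^sup>2) + 1 / (2 * real N * m\<^sup>2) + 1 / (2 * real N * m\<^sup>2)"
    using 1 r_bound[OF x] r_bound[OF half] by linarith
  also have "\<dots> = (pi + 2) / (2 * m\<^sup>2) / real N"
    using N m by (simp add: field_simps)
  finally show ?thesis by (simp add: m_def)
qed

text \<open>
  The series at \<open>\<pi>/2\<close> is twice Leibniz's series for \<open>\<pi>/4\<close>, so this point fixes the constant.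
\<close>

lemma odd_sine_sum_at_half_pi:
  "(\<lambda>N. \<Sum>k<N. 2 * sin (real (2 * k + 1) * (pi / 2)) / real (2 * k + 1)) \<longlonglongrightarrow> pi / 2"
proof -
  have "summable (\<lambda>k. (-1)^k * (1 / real (k*2+1) * 1 ^ (k*2+1)) :: real)"
    by (rule summable_arctan_series) simp
  then have "(\<lambda>k. (-1)^k * 1 / real (k*2+1)) sums (pi / 4)"
    by (simp add: pi_series summable_sums)
  from sums_mult[OF this, of 2] have "(\<lambda>k. 2 * ((-1)^k / real (2*k+1))) sums (pi / 2)"
    by (simp add: mult.commute)
  moreover have "sin (real (2 * k + 1) * (pi / 2)) = (-1) ^ k" for k
    using sin_cos_eq[of "real (2 * k + 1) * (pi / 2)"] cos_npi[of k] cos_minus[of "real k * pi"]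
    by (simp add: algebra_simps)
  ultimately show ?thesis
    by (simp add: sums_def)
qed

text \<open>
  The termwise derivative in \<open>x\<close> is the sine series of the previous lemmas, which converges to \<open>\<pi>/2\<close>
  uniformly on compact subintervals of \<open>(0, \<pi>)\<close>. So the sum differs from \<open>\<pi> x / 2\<close> by a constant
  there. The cosine series itself converges uniformly, hence its sum is continuous up to the end points,
  and its value at \<open>0\<close> shows that the constant vanishes.
\<close>

theorem odd_cosine_series:
  assumes "0 \<le> x" "x \<le> pi"
  shows "(\<lambda>k. 2 * (1 - cos (real (2 * k + 1) * x)) / (real (2 * k + 1))\<^sup>2) sums (pi * x / 2)"
proof -
  define f where "f k u = 2 * (1 - cos (real (2 * k + 1) * u)) / (real (2 * k + 1))\<^sup>2" for k u
  define F where "F u = (\<Sum>k. f k u)" for u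
  define s where "s N u = (\<Sum>k<N. 2 * sin (real (2 * k + 1) * u) / real (2 * k + 1))" for N u
  have f_bound: "norm (f k u) \<le> 4 * (1 / (real k + 1)\<^sup>2)" for k u
  proof -
    have "norm (f k u) = 2 * (1 - cos (real (2 * k + 1) * u)) / (real (2 * k + 1))\<^sup>2"
      by (simp add: f_def)
    also have "\<dots> \<le> 4 / (real k + 1)\<^sup>2"
    proof (intro frac_le power_mono)
      show "2 * (1 - cos (real (2 * k + 1) * u)) \<le> 4"
        using cos_ge_minus_one[of "real (2 * k + 1) * u"]
        by (simp only: right_diff_distrib)
    qed auto
    finally show ?thesis by simp
  qed
  have summ: "summable (\<lambda>k. 4 * (1 / (real k + 1)\<^sup>2))"
    using sums_summable[OF inverse_squares_sums] by (intro summable_mult) (simp add: add.commute)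
  have f_sums: "(\<lambda>k. f k u) sums F u" for u
    unfolding F_def using summable_comparison_test'[OF summ f_bound] by (rule summable_sums)
  have F_cont: "continuous_on {0..pi} F"
  proof (rule uniform_limit_theorem)
    show "uniform_limit {0..pi} (\<lambda>n u. \<Sum>k<n. f k u) F sequentially"
      unfolding F_def by (rule Weierstrass_m_test[OF f_bound summ])
    show "\<forall>\<^sub>F n in sequentially. continuous_on {0..pi} (\<lambda>u. \<Sum>k<n. f k u)"
      unfolding f_def by (intro always_eventually allI continuous_intros) auto
  qed simp
  have F_diff: "F u - pi / 2 * u = F (pi / 2) - pi / 2 * (pi / 2)" if u: "u \<in> {0<..<pi}" for u
  proof -
    obtain a where a: "0 < a" "a < pi / 2" "u \<in> {a..pi - a}"
    proof
      show "0 < min (min u (pi - u)) (pi / 4)" using u by auto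
      show "min (min u (pi - u)) (pi / 4) < pi / 2" using pi_gt_zero by linarith
      show "u \<in> {min (min u (pi - u)) (pi / 4)..pi - min (min u (pi - u)) (pi / 4)}"
        using u by auto
    qed
    \<comment> \<open>A bound for the distance of the differentiated partial sum from \<open>\<pi>/2\<close> on \<open>[a, \<pi> - a]\<close>.\<close>
    define B where "B N = (pi + 2) / (2 * (sin a)\<^sup>2) / real N + \<bar>s N (pi / 2) - pi / 2\<bar>" for N
    define G where "G N v = (\<Sum>k<N. f k v) - pi / 2 * v" for N v
    have G_bound: "norm (G N u - G N (pi / 2)) \<le> B N * norm (u - pi / 2)" if N: "N > 0" for N
    proof (rule field_differentiable_bound[where S = "{a..pi - a}" and f' = "\<lambda>v. s N v - pi / 2"])
      fix v assume v: "v \<in> {a..pi - a}"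
      have "(f k has_real_derivative 2 * sin (real (2 * k + 1) * v) / real (2 * k + 1)) (at v)" for k
        unfolding f_def
        by (rule derivative_eq_intros refl | simp add: divide_simps power2_eq_square)+
      then have "((\<lambda>v. \<Sum>k<N. f k v) has_real_derivative s N v) (at v)"
        unfolding s_def by (intro DERIV_sum)
      then have "(G N has_real_derivative s N v - pi / 2 * 1) (at v)"
        unfolding G_def by (intro DERIV_diff DERIV_cmult DERIV_ident)
      then show "(G N has_real_derivative s N v - pi / 2) (at v within {a..pi - a})"
        by (simp add: has_field_derivative_at_within)
      show "norm (s N v - pi / 2) \<le> B N"
        using odd_sine_sum_oscillation[OF a(1,2) N v] by (simp add: B_def s_def)
    qed (use a in auto)
    have "(\<lambda>N. \<bar>s N (pi / 2) - pi / 2\<bar>) \<longlonglongrightarrow> \<bar>pi / 2 - pi / 2\<bar>"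
      unfolding s_def by (intro tendsto_intros odd_sine_sum_at_half_pi)
    then have B_lim: "B \<longlonglongrightarrow> 0 + \<bar>pi / 2 - pi / 2\<bar>"
      unfolding B_def by (intro tendsto_add lim_const_over_n)
    have "(\<lambda>N. B N * norm (u - pi / 2)) \<longlonglongrightarrow> 0"
      using tendsto_mult_left_zero[of B] B_lim by simp
    then have "(\<lambda>N. G N u - G N (pi / 2)) \<longlonglongrightarrow> 0"
      by (rule Lim_null_comparison[rotated])
        (use G_bound in \<open>auto intro: eventually_sequentiallyI[of 1]\<close>)
    moreover have "(\<lambda>N. G N v) \<longlonglongrightarrow> F v - pi / 2 * v" for v
      unfolding G_def using f_sums[of v] by (intro tendsto_intros) (simp add: sums_def)
    then have "(\<lambda>N. G N u - G N (pi / 2)) \<longlonglongrightarrow> (F u - pi / 2 * u) - (F (pi / 2) - pi / 2 * (pi / 2))"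
      by (intro tendsto_diff)
    ultimately show ?thesis
      using LIMSEQ_unique by fastforce
  qed
  have const: "F u - pi / 2 * u = F (pi / 2) - pi / 2 * (pi / 2)" if "u \<in> {0..pi}" for u
  proof (rule continuous_constant_on_closure[where S = "{0<..<pi}" and f = "\<lambda>u. F u - pi / 2 * u"])
    show "continuous_on (closure {0<..<pi}) (\<lambda>u. F u - pi / 2 * u)"
      using F_cont by (auto intro!: continuous_intros)
  qed (use F_diff that in auto)
  have "F 0 = 0"
    by (simp add: F_def f_def)
  with const[of 0] const[of x] assms have "F x = pi * x / 2"
    by simp
  with f_sums[of x] show ?thesis
    by (simp add: f_def)
qed

section \<open>The eigenfunctions of the kernel min\<close>

text \<open>
  Indices start at \<open>0\<close>, so that \<open>k + 1/2\<close> plays the part of \<open>n - 1/2\<close> for \<open>n = k + 1\<close>.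
\<close>

definition kl_freq :: "real \<Rightarrow> nat \<Rightarrow> real" where
  "kl_freq T k = (real k + 1/2) * pi / T"

definition kl_basis :: "real \<Rightarrow> nat \<Rightarrow> real \<Rightarrow> real" where
  "kl_basis T k t = sqrt (2 / T) * sin (kl_freq T k * t)"

lemma kl_freq_pos: "T > 0 \<Longrightarrow> kl_freq T k > 0"
  by (simp add: kl_freq_def add_nonneg_pos)

lemma cos_kl_freq: "T > 0 \<Longrightarrow> cos (kl_freq T k * T) = 0"
proof -
  assume "T > 0"
  then have "kl_freq T k * T = real k * pi + pi / 2"
    by (simp add: kl_freq_def field_simps)
  then show ?thesis by (simp add: cos_add)
qed

text \<open>
  The kernel \<open>min\<close> is Green's function of \<open>- d\<^sup>2/dt\<^sup>2\<close> with a Dirichlet condition at \<open>0\<close> and a Neumann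
  condition at \<open>T\<close>. The assumption on \<open>cos (w * T)\<close> is the Neumann condition for the sine.
\<close>

lemma has_integral_sin_times_min:
  fixes w t T :: real
  assumes w: "w \<noteq> 0" and t: "0 \<le> t" "t \<le> T" and T: "cos (w * T) = 0"
  shows "((\<lambda>s. sin (w * s) * min s t) has_integral (sin (w * t) / w\<^sup>2)) {0..T}"
proof -
  have 1: "((\<lambda>s. sin (w * s) * s) has_integral
      (sin (w * t) / w\<^sup>2 - t * cos (w * t) / w) - (sin (w * 0) / w\<^sup>2 - 0 * cos (w * 0) / w)) {0..t}"
    by (rule fundamental_theorem_of_calculus[OF t(1)])
      (auto intro!: derivative_eq_intros simp: w power2_eq_square field_simps
        simp flip: has_real_derivative_iff_has_vector_derivative)
  have 2: "((\<lambda>s. sin (w * s) * t) has_integral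
      (- t * cos (w * T) / w) - (- t * cos (w * t) / w)) {t..T}"
    by (rule fundamental_theorem_of_calculus[OF t(2)])
      (auto intro!: derivative_eq_intros simp: w field_simps
        simp flip: has_real_derivative_iff_has_vector_derivative)
  have "((\<lambda>s. sin (w * s) * min s t) has_integral sin (w * t) / w\<^sup>2 - t * cos (w * t) / w) {0..t}"
    using 1 by (rule has_integral_eq_rhs[OF has_integral_eq[rotated]]) auto
  moreover have "((\<lambda>s. sin (w * s) * min s t) has_integral t * cos (w * t) / w) {t..T}"
    using 2 by (rule has_integral_eq_rhs[OF has_integral_eq[rotated]]) (auto simp: T)
  ultimately have "((\<lambda>s. sin (w * s) * min s t) has_integral
      (sin (w * t) / w\<^sup>2 - t * cos (w * t) / w) + t * cos (w * t) / w) {0..T}"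
    by (rule has_integral_combine[OF t])
  then show ?thesis by simp
qed

lemma has_integral_kl_basis_min:
  assumes "0 \<le> t" "t \<le> T" "T > 0"
  shows "((\<lambda>s. kl_basis T k s * min s t) has_integral (kl_basis T k t / (kl_freq T k)\<^sup>2)) {0..T}"
  using has_integral_mult_right[OF has_integral_sin_times_min[of "kl_freq T k" t T], of "sqrt (2 / T)"]
    assms kl_freq_pos[of T k] cos_kl_freq[of T k]
  by (simp add: kl_basis_def mult.assoc)

text \<open>
  The antiderivatives contain the sines of \<open>(w + v) T\<close> and \<open>(w - v) T\<close> only, and these vanish by
  the addition theorems because the cosines of \<open>w T\<close> and \<open>v T\<close> do.
\<close>

lemma has_integral_kl_basis_orthonormal:
  assumes T: "T > 0"
  shows "((\<lambda>s. kl_basis T j s * kl_basis T k s) has_integral (if j = k then 1 else 0)) {0..T}"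
proof -
  define w v where "w = kl_freq T j" and "v = kl_freq T k"
  have pos: "w > 0" "v > 0" using T by (auto simp: w_def v_def kl_freq_pos)
  have sinT: "sin ((w + v) * T) = 0" "sin ((w - v) * T) = 0"
    using cos_kl_freq[OF T, of j] cos_kl_freq[OF T, of k]
    by (simp_all add: w_def v_def distrib_right left_diff_distrib sin_add sin_diff)
  have "((\<lambda>s. sin (w * s) * sin (v * s)) has_integral (if j = k then T / 2 else 0)) {0..T}"
  proof (cases "j = k")
    case True
    then have wv: "w = v" by (simp add: w_def v_def)
    have "((\<lambda>s. sin (v * s) * sin (v * s)) has_integral
        (T / 2 - sin ((v + v) * T) / (4 * v)) - (0 / 2 - sin ((v + v) * 0) / (4 * v))) {0..T}"
    proof (rule fundamental_theorem_of_calculus)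
      fix s assume "s \<in> {0..T}"
      have "1 / 2 - cos ((v + v) * s) / 2 = sin (v * s) * sin (v * s)"
        using cos_double_sin[of "v * s"] by (simp add: power2_eq_square algebra_simps)
      moreover have "((\<lambda>s. s / 2 - sin ((v + v) * s) / (4 * v)) has_real_derivative
          1 / 2 - cos ((v + v) * s) / 2) (at s within {0..T})"
        using pos by (auto intro!: derivative_eq_intros simp: field_simps)
      ultimately show "((\<lambda>s. s / 2 - sin ((v + v) * s) / (4 * v)) has_vector_derivative
          sin (v * s) * sin (v * s)) (at s within {0..T})"
        by (simp flip: has_real_derivative_iff_has_vector_derivative)
    qed (use T in simp)
    then show ?thesis using True sinT(1) by (simp add: wv)
  next
    case False
    then have wv: "w \<noteq> v" using T by (simp add: w_def v_def kl_freq_def)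
    have "((\<lambda>s. sin (w * s) * sin (v * s)) has_integral
        (sin ((w - v) * T) / (2 * (w - v)) - sin ((w + v) * T) / (2 * (w + v))) -
        (sin ((w - v) * 0) / (2 * (w - v)) - sin ((w + v) * 0) / (2 * (w + v)))) {0..T}"
    proof (rule fundamental_theorem_of_calculus)
      fix s assume "s \<in> {0..T}"
      have "cos ((w - v) * s) / 2 - cos ((w + v) * s) / 2 = sin (w * s) * sin (v * s)"
        by (simp add: distrib_right left_diff_distrib cos_add cos_diff add_divide_distrib diff_divide_distrib)
      moreover have "((\<lambda>s. sin ((w - v) * s) / (2 * (w - v)) - sin ((w + v) * s) / (2 * (w + v)))
          has_real_derivative cos ((w - v) * s) / 2 - cos ((w + v) * s) / 2) (at s within {0..T})"
      proof -
        have "((\<lambda>s. sin (c * s) / (2 * c)) has_real_derivative cos (c * s) / 2) (at s within {0..T})"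
          if "c \<noteq> 0" for c
          using that by (auto intro!: derivative_eq_intros)
        from DERIV_diff[OF this this, of "w - v" "w + v"] show ?thesis
          using wv pos by simp
      qed
      ultimately show "((\<lambda>s. sin ((w - v) * s) / (2 * (w - v)) - sin ((w + v) * s) / (2 * (w + v)))
          has_vector_derivative sin (w * s) * sin (v * s)) (at s within {0..T})"
        by (simp flip: has_real_derivative_iff_has_vector_derivative)
    qed (use T in simp)
    then show ?thesis using False sinT by simp
  qed
  moreover have "sqrt (2 / T) * x * (sqrt (2 / T) * y) = 2 / T * (x * y)" for x y
  proof -
    have "sqrt (2 / T) * x * (sqrt (2 / T) * y) = (sqrt (2 / T) * sqrt (2 / T)) * (x * y)"
      by (simp only: mult_ac)
    then show ?thesis using T by (simp only: real_sqrt_mult_self) simp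
  qed
  ultimately show ?thesis
    using has_integral_mult_right[of "\<lambda>s. sin (w * s) * sin (v * s)" "if j = k then T / 2 else 0" "{0..T}" "2 / T"] T
    by (cases "j = k") (simp_all add: kl_basis_def w_def v_def)
qed

text \<open>
  This is the expansion of the kernel \<open>min\<close> on the diagonal in terms of its eigenfunctions. With
  \<open>2 sin\<^sup>2 \<theta> = 1 - cos 2\<theta>\<close> it is \<open>odd_cosine_series\<close> at \<open>x = \<pi> t / T\<close>.
\<close>

lemma kl_basis_squares_sums:
  assumes t: "0 \<le> t" "t \<le> T" and T: "T > 0"
  shows "(\<lambda>k. (kl_basis T k t)\<^sup>2 / (kl_freq T k)\<^sup>2) sums t"
proof -
  define x where "x = pi * t / T"
  have x: "0 \<le> x" "x \<le> pi"
    using t T by (simp_all add: x_def field_simps)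
  have term_eq: "(kl_basis T k t)\<^sup>2 / (kl_freq T k)\<^sup>2 =
      2 * T / pi\<^sup>2 * (2 * (1 - cos (real (2 * k + 1) * x)) / (real (2 * k + 1))\<^sup>2)" for k
  proof -
    have arg: "real (2 * k + 1) * x = 2 * (kl_freq T k * t)"
      using T by (simp add: x_def kl_freq_def field_simps)
    have "kl_freq T k = real (2 * k + 1) * pi / (2 * T)"
      using T by (simp add: kl_freq_def field_simps)
    then have freq: "(kl_freq T k)\<^sup>2 = (real (2 * k + 1))\<^sup>2 * pi\<^sup>2 / (4 * T\<^sup>2)"
      by (simp add: power_divide power_mult_distrib)
    have basis: "(kl_basis T k t)\<^sup>2 = 2 / T * (sin (kl_freq T k * t))\<^sup>2"
      using T by (simp add: kl_basis_def power_mult_distrib)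
    have gen: "2 / T * S / (q\<^sup>2 * pi\<^sup>2 / (4 * T\<^sup>2)) = 2 * T / pi\<^sup>2 * (2 * (1 - (1 - 2 * S)) / q\<^sup>2)"
      if "q \<noteq> 0" for S q :: real
      using that T by (simp add: field_simps power2_eq_square)
    show ?thesis
      unfolding arg basis cos_double_sin unfolding freq by (rule gen) simp
  qed
  have "2 * T / pi\<^sup>2 * (pi * x / 2) = t"
    using T by (simp add: x_def field_simps power2_eq_square)
  then show ?thesis
    unfolding term_eq using sums_mult[OF odd_cosine_series[OF x], of "2 * T / pi\<^sup>2"] by simp
qed

section \<open>Complex inner products\<close>

lemma cinner_add_left: "cinner (x + y) z = cinner x z + cinner y z"
  for x y z :: "'a::complex_inner"
  by (metis cinner_commute cinner_add_right complex_cnj_add)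

lemma cinner_scaleC_left: "cinner (c *\<^sub>C x) y = cnj c * cinner x y"
  for x y :: "'a::complex_inner"
  by (metis cinner_commute cinner_scaleC_right complex_cnj_mult)

lemma cinner_scaleR_right: "cinner x (r *\<^sub>R y) = r *\<^sub>R cinner x y"
  for x y :: "'a::complex_inner"
  using cinner_scaleC_right[of x "of_real r" y] by (simp add: scaleC_of_real scaleR_conv_of_real)

lemma cinner_scaleR_left: "cinner (r *\<^sub>R x) y = r *\<^sub>R cinner x y"
  for x y :: "'a::complex_inner"
  using cinner_scaleC_left[of "of_real r" x y] by (simp add: scaleC_of_real scaleR_conv_of_real)

lemma norm_add_squared: "(norm (x + y))\<^sup>2 = (norm x)\<^sup>2 + 2 * Re (cinner x y) + (norm y)\<^sup>2"
  for x y :: "'a::complex_inner"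
proof -
  have "complex_of_real ((norm (x + y))\<^sup>2) =
      cinner x x + (cinner x y + cnj (cinner x y)) + cinner y y"
    by (simp add: cinner_self[symmetric] cinner_add_left cinner_add_right
        cinner_commute[of y x, symmetric] del: of_real_power)
  then have "Re (complex_of_real ((norm (x + y))\<^sup>2)) =
      Re (cinner x x + (cinner x y + cnj (cinner x y)) + cinner y y)"
    by simp
  then show ?thesis
    by (simp add: cinner_self del: of_real_power)
qed

lemma norm_diff_squared: "(norm (x - y))\<^sup>2 = (norm x)\<^sup>2 - 2 * Re (cinner x y) + (norm y)\<^sup>2"
  for x y :: "'a::complex_inner"
  using norm_add_squared[of x "-1 *\<^sub>R y"] cinner_scaleR_right[of x "-1" y] by simp

text \<open>
  The norm is given, so the triangle inequality for \<open>x + z\<close> already bounds the real part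
  of \<open>cinner x z\<close>; a phase factor in \<open>z\<close> turns the real part into the modulus.
\<close>

lemma cinner_Cauchy_Schwarz: "cmod (cinner x y) \<le> norm x * norm y"
  for x y :: "'a::complex_inner"
proof -
  have Re_le: "Re (cinner x z) \<le> norm x * norm z" for z
  proof -
    have "(norm (x + z))\<^sup>2 \<le> (norm x + norm z)\<^sup>2"
      by (simp add: norm_triangle_ineq)
    then show ?thesis
      by (simp add: norm_add_squared power2_sum)
  qed
  show ?thesis
  proof (cases "cinner x y = 0")
    case False
    define u where "u = cnj (cinner x y) / cmod (cinner x y)"
    have u: "cmod u = 1" "u * cinner x y = cmod (cinner x y)"
      using False by (auto simp: u_def norm_divide mult.commute[of "cnj _"] complex_norm_square[symmetric] power2_eq_square)
    have "cmod (cinner x y) = Re (cinner x (u *\<^sub>C y))"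
      by (simp add: cinner_scaleC_right u)
    also have "\<dots> \<le> norm x * norm y"
      using Re_le[of "u *\<^sub>C y"] by (simp add: norm_scaleC u)
    finally show ?thesis .
  qed simp
qed

lemma bounded_bilinear_cinner: "bounded_bilinear (cinner :: 'a::complex_inner \<Rightarrow> 'a \<Rightarrow> complex)"
proof
  show "\<exists>K. \<forall>x y::'a. norm (cinner x y) \<le> norm x * norm y * K"
    by (intro exI[of _ 1]) (simp add: cinner_Cauchy_Schwarz)
qed (simp_all add: cinner_add_left cinner_add_right cinner_scaleR_left cinner_scaleR_right)

interpretation cinner: bounded_bilinear "cinner :: 'a::complex_inner \<Rightarrow> 'a \<Rightarrow> complex"
  by (rule bounded_bilinear_cinner)

lemma cinner_eq_zero_imp: "(\<And>y. cinner x y = 0) \<Longrightarrow> x = 0"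
  for x :: "'a::complex_inner"
  using cinner_self[of x] by simp

section \<open>Expansion of a curve with covariance proportional to min\<close>

text \<open>
  Bessel's identity. The vectors \<open>Z k\<close> are not normalised and may even be zero (as they are for
  \<open>\<alpha> = 0\<close>), which is why the inner products with \<open>v\<close> are assumed in the form \<open>lam k * c k\<close> instead of
  defining \<open>c k\<close> by a quotient.
\<close>

lemma norm_orthogonal_remainder:
  fixes Z :: "nat \<Rightarrow> 'a::complex_inner" and lam c :: "nat \<Rightarrow> real"
  assumes orth: "\<And>j k. cinner (Z j) (Z k) = (if j = k then complex_of_real (lam j) else 0)"
    and coeff: "\<And>k. cinner (Z k) v = complex_of_real (lam k * c k)"
  shows "(norm (v - (\<Sum>k<n. c k *\<^sub>R Z k)))\<^sup>2 = (norm v)\<^sup>2 - (\<Sum>k<n. lam k * (c k)\<^sup>2)"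
proof (induction n)
  case (Suc n)
  define r where "r = v - (\<Sum>k<n. c k *\<^sub>R Z k)"
  have "cinner (Z n) r = complex_of_real (lam n * c n)"
    by (simp add: r_def cinner.diff_right cinner.sum_right cinner_scaleR_right coeff orth)
  then have "Re (cinner r (Z n)) = lam n * c n"
    using cinner_commute[of r "Z n"] by simp
  moreover have "complex_of_real ((norm (Z n))\<^sup>2) = complex_of_real (lam n)"
    using orth[of n n] unfolding cinner_self by simp
  then have "(norm (Z n))\<^sup>2 = lam n"
    unfolding of_real_eq_iff .
  ultimately have "(norm (r - c n *\<^sub>R Z n))\<^sup>2 =
      (norm r)\<^sup>2 - 2 * (c n * (lam n * c n)) + (c n)\<^sup>2 * lam n"
    by (simp add: norm_diff_squared cinner_scaleR_right power_mult_distrib)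
  then have "(norm (r - c n *\<^sub>R Z n))\<^sup>2 = (norm r)\<^sup>2 - lam n * (c n)\<^sup>2"
    by (simp add: power2_eq_square)
  with Suc show ?case
    by (simp add: r_def algebra_simps)
qed simp

text \<open>
  The setting of the Karhunen-Loeve expansion, freed from operators: a curve in a Hilbert space with the
  covariance of a Brownian motion of variance parameter \<open>c\<close>.
\<close>

locale min_covariance =
  fixes f :: "real \<Rightarrow> 'l::chilbert_space" and c T :: real
  assumes T_pos: "T > 0"
    and continuous: "continuous_on {0..T} f"
    and covariance: "\<And>s t. s \<in> {0..T} \<Longrightarrow> t \<in> {0..T} \<Longrightarrow>
      cinner (f s) (f t) = complex_of_real (c * min s t)"
begin

definition Z :: "nat \<Rightarrow> 'l" where
  "Z k = integral {0..T} (\<lambda>s. kl_basis T k s *\<^sub>R f s)"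

lemma integrable_Z: "(\<lambda>s. kl_basis T k s *\<^sub>R f s) integrable_on {0..T}"
  unfolding kl_basis_def by (intro integrable_continuous_real continuous_intros continuous)

lemma has_integral_Z: "((\<lambda>s. kl_basis T k s *\<^sub>R f s) has_integral Z k) {0..T}"
  unfolding Z_def by (rule integrable_integral[OF integrable_Z])

text \<open>
  The inner product with \<open>f t\<close> passes under the integral defining \<open>Z k\<close> and leaves the integral
  operator with kernel \<open>c * min s t\<close> applied to an eigenfunction.
\<close>

lemma cinner_Z_curve:
  assumes t: "t \<in> {0..T}"
  shows "cinner (Z k) (f t) = complex_of_real (c / (kl_freq T k)\<^sup>2 * kl_basis T k t)"
proof -
  have "((\<lambda>s. c * (kl_basis T k s * min s t)) has_integral
      c * (kl_basis T k t / (kl_freq T k)\<^sup>2)) {0..T}"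
    using t T_pos by (intro has_integral_mult_right has_integral_kl_basis_min) auto
  from has_integral_linear[OF this bounded_linear_of_real[where 'a = complex]]
  have "((\<lambda>s. cinner (kl_basis T k s *\<^sub>R f s) (f t)) has_integral
      complex_of_real (c * (kl_basis T k t / (kl_freq T k)\<^sup>2))) {0..T}"
    by (rule has_integral_eq[rotated])
      (use t in \<open>simp add: cinner_scaleR_left covariance scaleR_conv_of_real\<close>)
  moreover have "((\<lambda>s. cinner (kl_basis T k s *\<^sub>R f s) (f t)) has_integral cinner (Z k) (f t)) {0..T}"
    using has_integral_linear[OF has_integral_Z cinner.bounded_linear_left[of "f t"]]
    unfolding o_def .
  ultimately have "cinner (Z k) (f t) = complex_of_real (c * (kl_basis T k t / (kl_freq T k)\<^sup>2))"
    by (rule has_integral_unique[rotated])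
  then show ?thesis by simp
qed

lemma cinner_Z:
  "cinner (Z j) (Z k) = (if j = k then complex_of_real (c / (kl_freq T j)\<^sup>2) else 0)"
proof -
  have "((\<lambda>s. c / (kl_freq T j)\<^sup>2 * (kl_basis T j s * kl_basis T k s)) has_integral
      c / (kl_freq T j)\<^sup>2 * (if j = k then 1 else 0)) {0..T}"
    by (intro has_integral_mult_right has_integral_kl_basis_orthonormal T_pos)
  from has_integral_linear[OF this bounded_linear_of_real[where 'a = complex]]
  have "((\<lambda>s. cinner (Z j) (kl_basis T k s *\<^sub>R f s)) has_integral
      complex_of_real (c / (kl_freq T j)\<^sup>2 * (if j = k then 1 else 0))) {0..T}"
    by (rule has_integral_eq[rotated])
      (simp add: cinner_scaleR_right cinner_Z_curve scaleR_conv_of_real)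
  moreover have "((\<lambda>s. cinner (Z j) (kl_basis T k s *\<^sub>R f s)) has_integral cinner (Z j) (Z k)) {0..T}"
    using has_integral_linear[OF has_integral_Z cinner.bounded_linear_right[of "Z j"]]
    unfolding o_def .
  ultimately have "cinner (Z j) (Z k) = complex_of_real (c / (kl_freq T j)\<^sup>2 * (if j = k then 1 else 0))"
    by (rule has_integral_unique[rotated])
  then show ?thesis by simp
qed

text \<open>
  By Bessel's identity the squared norm of the remainder is \<open>c\<close> times the remainder of the series in
  \<open>kl_basis_squares_sums\<close>.
\<close>

theorem karhunen_loeve:
  assumes t: "t \<in> {0..T}"
  shows "(\<lambda>k. kl_basis T k t *\<^sub>R Z k) sums f t"
proof -
  have "complex_of_real ((norm (f t))\<^sup>2) = complex_of_real (c * t)"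
    using covariance[OF t t] unfolding cinner_self by simp
  then have norm_f: "(norm (f t))\<^sup>2 = c * t"
    unfolding of_real_eq_iff .
  have rem: "(norm (f t - (\<Sum>k<n. kl_basis T k t *\<^sub>R Z k)))\<^sup>2 =
      c * t - c * (\<Sum>k<n. (kl_basis T k t)\<^sup>2 / (kl_freq T k)\<^sup>2)" for n
    using norm_orthogonal_remainder[OF cinner_Z cinner_Z_curve[OF t], of n]
    by (simp add: norm_f sum_distrib_left)
  have "(\<lambda>n. \<Sum>k<n. (kl_basis T k t)\<^sup>2 / (kl_freq T k)\<^sup>2) \<longlonglongrightarrow> t"
    using kl_basis_squares_sums t T_pos unfolding sums_def by simp
  then have "(\<lambda>n. (norm (f t - (\<Sum>k<n. kl_basis T k t *\<^sub>R Z k)))\<^sup>2) \<longlonglongrightarrow> c * t - c * t"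
    unfolding rem by (intro tendsto_intros)
  then have "(\<lambda>n. sqrt ((norm (f t - (\<Sum>k<n. kl_basis T k t *\<^sub>R Z k)))\<^sup>2)) \<longlonglongrightarrow> sqrt 0"
    by (intro tendsto_real_sqrt) simp
  then have "(\<lambda>n. norm (f t - (\<Sum>k<n. kl_basis T k t *\<^sub>R Z k))) \<longlonglongrightarrow> 0"
    by simp
  then have "(\<lambda>n. (\<Sum>k<n. kl_basis T k t *\<^sub>R Z k) - f t) \<longlonglongrightarrow> 0"
    unfolding norm_minus_commute[of "f t"] by (rule tendsto_norm_zero_cancel)
  then show ?thesis
    unfolding sums_def by (rule LIM_zero_cancel)
qed

end

section \<open>Adjoints and composition of operators\<close>

lemma is_adjoint_unique:
  fixes a b c :: "'h::complex_inner op"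
  assumes "is_adjoint b a" "is_adjoint c a"
  shows "b = c"
proof (rule blinfun_eqI)
  fix x
  have "cinner (b x - c x) y = 0" for y
    using assms by (simp add: is_adjoint_def cinner.diff_left)
  then show "b x = c x"
    using cinner_eq_zero_imp by fastforce
qed

lemma adj_eqI: "is_adjoint b a \<Longrightarrow> adj a = b"
  unfolding adj_def by (rule the_equality) (auto intro: is_adjoint_unique)

lemma is_adjoint_sym: "is_adjoint b a \<Longrightarrow> is_adjoint a b"
  unfolding is_adjoint_def by (metis cinner_commute)

lemma is_adjoint_add: "is_adjoint b a \<Longrightarrow> is_adjoint d c \<Longrightarrow> is_adjoint (b + d) (a + c)"
  by (simp add: is_adjoint_def blinfun.add_left cinner_add_left cinner_add_right)

lemma is_adjoint_scaleC: "is_adjoint b a \<Longrightarrow> is_adjoint (cnj c *\<^sub>C b) (c *\<^sub>C a)"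
  by (simp add: is_adjoint_def blinfun_apply_scaleC cinner_scaleC_left cinner_scaleC_right)

lemma scaleC_compose_left: "(c *\<^sub>C a) o\<^sub>L b = c *\<^sub>C (a o\<^sub>L b)"
  by (rule blinfun_eqI) (simp add: blinfun_apply_scaleC)

lemma scaleC_compose_right: "clinear_op a \<Longrightarrow> a o\<^sub>L (c *\<^sub>C b) = c *\<^sub>C (a o\<^sub>L b)"
  by (rule blinfun_eqI) (simp add: blinfun_apply_scaleC clinear_op_def)

interpretation blinfun_compose: bounded_bilinear blinfun_compose
  by (rule bounded_bilinear_blinfun_compose)

section \<open>The 2-norm completion of a tracial algebra\<close>

text \<open>
  The inner product and the involution of \<open>L\<^sup>2\<close> are determined by the product, the adjoint and the state,
  so the setting is algebraic: a unital star-algebra with a tracial state, and its 2-norm completion.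
\<close>

locale tracial_L2 =
  fixes A :: "'h::chilbert_space op set"
    and \<phi> :: "'h op \<Rightarrow> complex"
    and \<iota> :: "'h op \<Rightarrow> 'l::chilbert_space"
  assumes algebra: "unital_star_algebra A"
    and state: "state_on A \<phi>"
    and tracial: "tracial_on A \<phi>"
    and completion: "L2_completion A \<phi> \<iota>"
begin

lemma
  assumes "a \<in> A"
  shows clinear: "clinear_op a"
    and is_adjoint_adj: "is_adjoint (adj a) a"
    and adj_in [simp]: "adj a \<in> A"
    and scaleC_in [simp]: "c *\<^sub>C a \<in> A"
    and scaleR_in [simp]: "r *\<^sub>R a \<in> A"
    and uminus_in [simp]: "- a \<in> A"
proof -
  show *: "c *\<^sub>C a \<in> A" for c
    using algebra assms by (simp add: unital_star_algebra_def)
  show "r *\<^sub>R a \<in> A" for r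
    using *[of "of_real r"] by (simp add: scaleC_of_real)
  from this[of "-1"] show "- a \<in> A" by simp
  obtain b where "b \<in> A" "is_adjoint b a"
    using algebra assms unfolding unital_star_algebra_def by blast
  then show "is_adjoint (adj a) a" "adj a \<in> A"
    using adj_eqI by auto
qed (use algebra assms in \<open>simp_all add: unital_star_algebra_def\<close>)

lemma id_in [simp]: "id_blinfun \<in> A"
  using algebra by (simp add: unital_star_algebra_def)

lemma
  assumes "a \<in> A" "b \<in> A"
  shows add_in [simp]: "a + b \<in> A"
    and diff_in [simp]: "a - b \<in> A"
    and compose_in [simp]: "a o\<^sub>L b \<in> A"
proof -
  have *: "a + c \<in> A" if "c \<in> A" for c
    using algebra assms(1) that by (simp add: unital_star_algebra_def)
  show "a + b \<in> A" "a - b \<in> A"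
    using *[of b] *[of "- b"] assms by simp_all
qed (use algebra assms in \<open>simp_all add: unital_star_algebra_def\<close>)

lemma adj_adj [simp]: "a \<in> A \<Longrightarrow> adj (adj a) = a"
  by (rule adj_eqI[OF is_adjoint_sym[OF is_adjoint_adj]])

lemma adj_add: "a \<in> A \<Longrightarrow> b \<in> A \<Longrightarrow> adj (a + b) = adj a + adj b"
  by (intro adj_eqI is_adjoint_add is_adjoint_adj)

lemma adj_scaleC: "a \<in> A \<Longrightarrow> adj (c *\<^sub>C a) = cnj c *\<^sub>C adj a"
  by (intro adj_eqI is_adjoint_scaleC is_adjoint_adj)

lemma
  assumes "a \<in> A"
  shows state_scaleC: "\<phi> (c *\<^sub>C a) = c * \<phi> a"
    and state_scaleR: "\<phi> (r *\<^sub>R a) = of_real r * \<phi> a"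
    and emb_scaleC: "\<iota> (c *\<^sub>C a) = c *\<^sub>C \<iota> a"
    and emb_scaleR: "\<iota> (r *\<^sub>R a) = r *\<^sub>R \<iota> a"
proof -
  show 1: "\<phi> (c *\<^sub>C a) = c * \<phi> a" for c
    using state assms by (simp add: state_on_def)
  show "\<phi> (r *\<^sub>R a) = of_real r * \<phi> a"
    using 1[of "of_real r"] by (simp add: scaleC_of_real)
  show 2: "\<iota> (c *\<^sub>C a) = c *\<^sub>C \<iota> a" for c
    using completion assms by (simp add: L2_completion_def)
  show "\<iota> (r *\<^sub>R a) = r *\<^sub>R \<iota> a"
    using 2[of "of_real r"] by (simp add: scaleC_of_real)
qed

lemma
  assumes "a \<in> A" "b \<in> A"
  shows state_add: "\<phi> (a + b) = \<phi> a + \<phi> b"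
    and state_diff: "\<phi> (a - b) = \<phi> a - \<phi> b"
    and emb_add: "\<iota> (a + b) = \<iota> a + \<iota> b"
    and emb_diff: "\<iota> (a - b) = \<iota> a - \<iota> b"
proof -
  have 1: "\<phi> (a + c) = \<phi> a + \<phi> c" if "c \<in> A" for c
    using state assms(1) that by (simp add: state_on_def)
  show "\<phi> (a + b) = \<phi> a + \<phi> b" "\<phi> (a - b) = \<phi> a - \<phi> b"
    using 1[of b] 1[of "- b"] state_scaleR[of b "-1"] assms by simp_all
  have 2: "\<iota> (a + c) = \<iota> a + \<iota> c" if "c \<in> A" for c
    using completion assms(1) that by (simp add: L2_completion_def)
  show "\<iota> (a + b) = \<iota> a + \<iota> b" "\<iota> (a - b) = \<iota> a - \<iota> b"
    using 2[of b] 2[of "- b"] emb_scaleR[of b "-1"] assms by simp_all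
qed

lemma state_id [simp]: "\<phi> id_blinfun = 1"
  using state by (simp add: state_on_def)

lemma state_commute: "a \<in> A \<Longrightarrow> b \<in> A \<Longrightarrow> \<phi> (a o\<^sub>L b) = \<phi> (b o\<^sub>L a)"
  using tracial by (simp add: tracial_on_def)

lemma state_adj_self: "a \<in> A \<Longrightarrow> \<phi> (adj a o\<^sub>L a) = cinner (\<iota> a) (\<iota> a)"
proof -
  assume a: "a \<in> A"
  then have "\<phi> (adj a o\<^sub>L a) \<in> \<real>\<^sub>\<ge>\<^sub>0"
    using state by (simp add: state_on_def)
  moreover have "norm (\<iota> a) = norm2 \<phi> a"
    using completion a by (simp add: L2_completion_def)
  moreover from calculation have "\<phi> (adj a o\<^sub>L a) = of_real (Re (\<phi> (adj a o\<^sub>L a)))"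
    "0 \<le> Re (\<phi> (adj a o\<^sub>L a))"
    by (simp_all add: complex_nonneg_Reals_iff complex_eq_iff)
  ultimately show ?thesis
    by (metis cinner_self norm2_def real_sqrt_pow2)
qed

text \<open>
  Polarisation. Both sides are sesquilinear in \<open>(a, b)\<close> and agree on the diagonal, so their difference
  \<open>D\<close> satisfies \<open>D a b + D b a = 0\<close>. Replacing \<open>b\<close> by \<open>\<i> b\<close> gives \<open>D a b - D b a = 0\<close>.
\<close>

lemma cinner_emb:
  assumes a: "a \<in> A" and b: "b \<in> A"
  shows "cinner (\<iota> a) (\<iota> b) = \<phi> (adj a o\<^sub>L b)"
proof -
  define D where "D x y = \<phi> (adj x o\<^sub>L y) - cinner (\<iota> x) (\<iota> y)" for x y
  have D_add: "D (x + y) (x + y) = D x x + D x y + D y x + D y y" if "x \<in> A" "y \<in> A" for x y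
    using that by (simp add: D_def adj_add emb_add blinfun_compose.add_left
        blinfun_compose.add_right state_add cinner_add_left cinner_add_right)
  have D_self: "D x x = 0" if "x \<in> A" for x
    using that by (simp add: D_def state_adj_self)
  have D_skew: "D x y + D y x = 0" if "x \<in> A" "y \<in> A" for x y
    using D_add[OF that] that by (simp add: D_self)
  have "D a (\<i> *\<^sub>C b) = \<i> * D a b" "D (\<i> *\<^sub>C b) a = - \<i> * D b a"
    using a b by (simp_all add: D_def adj_scaleC emb_scaleC scaleC_compose_left
        scaleC_compose_right clinear state_scaleC cinner_scaleC_left cinner_scaleC_right
        algebra_simps)
  with D_skew[of a "\<i> *\<^sub>C b"] a b have "\<i> * (D a b - D b a) = 0"
    by (simp add: algebra_simps)
  then have "D a b = D b a" by simp
  with D_skew[OF a b] have "D a b = 0" by simp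
  then show ?thesis by (simp add: D_def)
qed

text \<open>
  The vectors fixed by the antiunitary extension \<open>J\<close> of \<open>\<iota> a \<mapsto> \<iota> (a\<^sup>*)\<close>. Expressing \<open>J \<xi> = \<xi>\<close> weakly,
  by inner products with the dense subspace \<open>\<iota> ` A\<close>, avoids the construction of \<open>J\<close> and
  is visibly preserved by integration.
\<close>

definition L2_selfadjoint :: "'l \<Rightarrow> bool" where
  "L2_selfadjoint \<xi> \<longleftrightarrow> (\<forall>c\<in>A. cinner \<xi> (\<iota> c) = cinner (\<iota> (adj c)) \<xi>)"

lemma L2_selfadjoint_emb:
  assumes "a \<in> A" "selfadjoint a"
  shows "L2_selfadjoint (\<iota> a)"
proof -
  have "adj a = a"
    using assms(2) by (rule adj_eqI)
  then have "cinner (\<iota> a) (\<iota> c) = cinner (\<iota> (adj c)) (\<iota> a)" if "c \<in> A" for c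
    using assms(1) that by (simp add: cinner_emb state_commute[of a c])
  then show ?thesis
    unfolding L2_selfadjoint_def by blast
qed

lemma L2_selfadjoint_integral:
  assumes "f integrable_on S" and "\<And>t. t \<in> S \<Longrightarrow> L2_selfadjoint (f t)"
  shows "L2_selfadjoint (integral S f)"
  unfolding L2_selfadjoint_def
proof
  fix c assume c: "c \<in> A"
  have "cinner (integral S f) (\<iota> c) = integral S (\<lambda>t. cinner (f t) (\<iota> c))"
    using integral_linear[OF assms(1) cinner.bounded_linear_left[of "\<iota> c"]]
    unfolding o_def by (rule sym)
  also have "\<dots> = integral S (\<lambda>t. cinner (\<iota> (adj c)) (f t))"
    using assms(2) c by (intro integral_cong) (simp add: L2_selfadjoint_def)
  also have "\<dots> = cinner (\<iota> (adj c)) (integral S f)"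
    using integral_linear[OF assms(1) cinner.bounded_linear_right[of "\<iota> (adj c)"]]
    unfolding o_def .
  finally show "cinner (integral S f) (\<iota> c) = cinner (\<iota> (adj c)) (integral S f)" .
qed

lemma L2_selfadjoint_scaleR: "L2_selfadjoint \<xi> \<Longrightarrow> L2_selfadjoint (r *\<^sub>R \<xi>)"
  by (simp add: L2_selfadjoint_def cinner_scaleR_left cinner_scaleR_right)

text \<open>
  This is \<open>\<parallel>J (\<iota> a - \<xi>)\<parallel> = \<parallel>\<iota> a - \<xi>\<parallel>\<close>, obtained by expanding both squared norms; traciality makes
  \<open>\<iota> a\<close> and \<open>\<iota> (adj a)\<close> equally long.
\<close>

lemma norm_emb_adj_diff:
  assumes \<xi>: "L2_selfadjoint \<xi>" and a: "a \<in> A"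
  shows "norm (\<iota> (adj a) - \<xi>) = norm (\<iota> a - \<xi>)"
proof -
  have "cinner (\<iota> (adj a)) (\<iota> (adj a)) = cinner (\<iota> a) (\<iota> a)"
    using a state_commute[OF a adj_in[OF a]] by (simp add: cinner_emb)
  then have "(norm (\<iota> (adj a)))\<^sup>2 = (norm (\<iota> a))\<^sup>2"
    unfolding cinner_self of_real_eq_iff .
  moreover have "Re (cinner (\<iota> (adj a)) \<xi>) = Re (cinner (\<iota> a) \<xi>)"
    using \<xi> a cinner_commute[of "\<iota> a" \<xi>] by (simp add: L2_selfadjoint_def)
  ultimately have "(norm (\<iota> (adj a) - \<xi>))\<^sup>2 = (norm (\<iota> a - \<xi>))\<^sup>2"
    by (simp add: norm_diff_squared)
  then show ?thesis by simp
qed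

text \<open>
  Let \<open>\<iota> a\<^sub>n \<longlonglongrightarrow> \<xi>\<close> and \<open>\<iota> b\<^sub>n \<longlonglongrightarrow> \<eta>\<close>. Then \<open>\<phi> (a\<^sub>n b\<^sub>n)\<close> is the inner product of \<open>\<iota> (a\<^sub>n\<^sup>*)\<close> and
  \<open>\<iota> b\<^sub>n\<close>, and \<open>\<iota> (a\<^sub>n\<^sup>*)\<close> tends to \<open>\<xi>\<close> as well by the preceding lemma. The limit value is unique
  since such sequences exist by density.
\<close>

lemma phi_mult_eq_cinner:
  assumes "L2_selfadjoint \<xi>"
  shows "phi_mult A \<phi> \<iota> \<xi> \<eta> = cinner \<xi> \<eta>"
  unfolding phi_mult_def
proof (rule the_equality)
  have conv: "(\<lambda>n. \<phi> (a n o\<^sub>L b n)) \<longlonglongrightarrow> cinner \<xi> \<eta>"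
    if "\<And>n. a n \<in> A \<and> b n \<in> A" "(\<lambda>n. \<iota> (a n)) \<longlonglongrightarrow> \<xi>" "(\<lambda>n. \<iota> (b n)) \<longlonglongrightarrow> \<eta>" for a b
  proof -
    have "(\<lambda>n. \<iota> (adj (a n))) \<longlonglongrightarrow> \<xi>"
      using that(1,2) assms by (simp add: tendsto_iff dist_norm norm_emb_adj_diff)
    from cinner.tendsto[OF this that(3)] show ?thesis
      using that(1) by (simp add: cinner_emb)
  qed
  then show "\<forall>a b. (\<forall>n. a n \<in> A \<and> b n \<in> A) \<and> (\<lambda>n. \<iota> (a n)) \<longlonglongrightarrow> \<xi> \<and> (\<lambda>n. \<iota> (b n)) \<longlonglongrightarrow> \<eta> \<longrightarrow>
      (\<lambda>n. \<phi> (a n o\<^sub>L b n)) \<longlonglongrightarrow> cinner \<xi> \<eta>"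
    by blast
  have approx: "\<exists>a. (\<forall>n. a n \<in> A) \<and> (\<lambda>n. \<iota> (a n)) \<longlonglongrightarrow> \<zeta>" for \<zeta>
  proof -
    have "\<zeta> \<in> closure (\<iota> ` A)"
      using completion by (simp add: L2_completion_def)
    then obtain z where "\<And>n. z n \<in> \<iota> ` A" "z \<longlonglongrightarrow> \<zeta>"
      unfolding closure_sequential by blast
    moreover from this(1) obtain a where a: "\<And>n. a n \<in> A \<and> z n = \<iota> (a n)"
      unfolding image_iff by metis
    moreover from a have "z = (\<lambda>n. \<iota> (a n))"
      by auto
    ultimately show ?thesis
      by blast
  qed
  fix c
  assume c: "\<forall>a b. (\<forall>n. a n \<in> A \<and> b n \<in> A) \<and> (\<lambda>n. \<iota> (a n)) \<longlonglongrightarrow> \<xi> \<and> (\<lambda>n. \<iota> (b n)) \<longlonglongrightarrow> \<eta> \<longrightarrow>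
      (\<lambda>n. \<phi> (a n o\<^sub>L b n)) \<longlonglongrightarrow> c"
  obtain a b where ab: "\<And>n. a n \<in> A \<and> b n \<in> A"
    "(\<lambda>n. \<iota> (a n)) \<longlonglongrightarrow> \<xi>" "(\<lambda>n. \<iota> (b n)) \<longlonglongrightarrow> \<eta>"
    using approx[of \<xi>] approx[of \<eta>] by auto
  show "c = cinner \<xi> \<eta>"
    using conv[OF ab] c ab by (meson LIMSEQ_unique)
qed

end

section \<open>The first two free cumulants\<close>

lemma NC_1_proper: "NC (Suc 0) - {{{..<Suc 0}}} = {}"
proof (rule ccontr)
  assume "NC (Suc 0) - {{{..<Suc 0}}} \<noteq> {}"
  then obtain P where P: "P \<in> NC (Suc 0) - {{{..<Suc 0}}}" by blast
  then have part: "\<Union>P = {0}" "{} \<notin> P"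
    by (auto simp: NC_def partition_on_def)
  have "V = {}" if "V \<in> P" for V
    using NC_proper_block[OF P that] by auto
  with part show False by auto
qed

text \<open>
  In a partition of a two-element set other than the one-block partition, all blocks are singletons.
\<close>

lemma NC_2_proper: "NC (Suc (Suc 0)) - {{{..<Suc (Suc 0)}}} = {{{0}, {Suc 0}}}"
proof
  show "NC (Suc (Suc 0)) - {{{..<Suc (Suc 0)}}} \<subseteq> {{{0}, {Suc 0}}}"
  proof
    fix P assume P: "P \<in> NC (Suc (Suc 0)) - {{{..<Suc (Suc 0)}}}"
    then have part: "\<Union>P = {0, Suc 0}" "{} \<notin> P"
      by (auto simp: NC_def partition_on_def)
    have "V = {0} \<or> V = {Suc 0}" if "V \<in> P" for V
    proof -
      have "V \<subset> {0, Suc 0}"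
        using NC_proper_block[OF P that] by (auto simp: lessThan_Suc)
      moreover have "V \<noteq> {}" using that part by auto
      ultimately show ?thesis by auto
    qed
    then have "P \<subseteq> {{0}, {Suc 0}}" by blast
    moreover have "\<exists>V\<in>P. 0 \<in> V" "\<exists>V\<in>P. Suc 0 \<in> V" using part by auto
    ultimately show "P \<in> {{{0}, {Suc 0}}}" by auto
  qed
  show "{{{0}, {Suc 0}}} \<subseteq> NC (Suc (Suc 0)) - {{{..<Suc (Suc 0)}}}"
    by (auto simp: NC_def noncrossing_def partition_on_def disjoint_def)
qed

lemma op_prod_single: "op_prod [a] = a"
  by (simp add: op_prod_def blinfun_eqI)

lemma op_prod_pair: "op_prod [a, b] = a o\<^sub>L b"
  by (rule blinfun_eqI) (simp add: op_prod_def)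

lemma free_cumulant1_1: "free_cumulant1 \<phi> 1 a = \<phi> a"
  by (simp add: free_cumulant.simps[of \<phi> "[a]"] NC_1_proper op_prod_single)

lemma free_cumulant1_2: "free_cumulant1 \<phi> 2 a = \<phi> (a o\<^sub>L a) - \<phi> a * \<phi> a"
proof -
  have "free_cumulant \<phi> [a] = \<phi> a"
    using free_cumulant1_1[of \<phi> a] by simp
  moreover have "nths [a, a] {0} = [a]" "nths [a, a] {Suc 0} = [a]"
    by (simp_all add: nths_Cons)
  ultimately show ?thesis
    by (simp add: numeral_2_eq_2 free_cumulant.simps[of \<phi> "[a, a]"] NC_2_proper op_prod_pair)
qed

section \<open>The covariance of the free Poisson process\<close>

context tracial_L2
begin

lemma state_compose_centred:
  assumes "a \<in> A" "b \<in> A"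
  shows "\<phi> ((a - p *\<^sub>C id_blinfun) o\<^sub>L (b - q *\<^sub>C id_blinfun)) =
    \<phi> (a o\<^sub>L b) - p * \<phi> b - q * \<phi> a + p * q"
proof -
  have id: "id_blinfun o\<^sub>L c = c" "c o\<^sub>L id_blinfun = c" for c :: "'h op"
    by (simp_all add: blinfun_eqI)
  have "(a - p *\<^sub>C id_blinfun) o\<^sub>L (b - q *\<^sub>C id_blinfun) =
      ((a o\<^sub>L b) - p *\<^sub>C b) - (q *\<^sub>C a - (p * q) *\<^sub>C id_blinfun)"
    using assms by (simp add: blinfun_compose.diff_left blinfun_compose.diff_right
        scaleC_compose_left scaleC_compose_right clinear id scaleC_scaleC)
  then show ?thesis
    using assms by (simp add: state_diff state_scaleC)
qed

lemma centred_in_generated_star_algebra: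
  "a - p *\<^sub>C id_blinfun \<in> generated_star_algebra {a}"
proof -
  have "a + complex_of_real (- 1) *\<^sub>C (p *\<^sub>C id_blinfun) \<in> B" if "unital_star_algebra B" "a \<in> B" for B
    using that unfolding unital_star_algebra_def by blast
  moreover have "a + complex_of_real (- 1) *\<^sub>C (p *\<^sub>C id_blinfun) = a - p *\<^sub>C id_blinfun"
    unfolding scaleC_of_real by simp
  ultimately show ?thesis
    by (auto simp: generated_star_algebra_def)
qed

text \<open>
  The alternating word of length two in the centred variables has state zero.
\<close>

lemma freely_independent_state_compose:
  assumes "freely_independent \<phi> I a" "i \<in> I" "j \<in> I" "i \<noteq> j" "a i \<in> A" "a j \<in> A"
  shows "\<phi> (a i o\<^sub>L a j) = \<phi> (a i) * \<phi> (a j)"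
proof -
  define z where "z k = a k - \<phi> (a k) *\<^sub>C id_blinfun" for k
  have z: "\<phi> (z k) = 0" "z k \<in> generated_star_algebra {a k}" if "a k \<in> A" for k
    using that by (simp_all add: z_def state_diff state_scaleC centred_in_generated_star_algebra)
  have "\<phi> (op_prod [z i, z j]) = 0"
    using assms z unfolding freely_independent_def free_subalgebras_def
    by (elim allE[of _ "[i, j]"] allE[of _ "[z i, z j]"]) simp
  then show ?thesis
    using assms by (simp add: op_prod_pair z_def state_compose_centred)
qed

text \<open>
  Split \<open>X t = X s + (X t - X s)\<close>. The second cumulant gives \<open>\<phi> (X s X s)\<close>, freeness of the increments over
  \<open>[0, s]\<close> and \<open>[s, t]\<close> gives \<open>\<phi> (X s (X t - X s))\<close>, and centring removes the product of the means.
  The degenerate cases \<open>s = 0\<close> and \<open>s = t\<close> are separate because the cumulant and freeness conditions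
  speak of strictly increasing times.
\<close>

lemma free_poisson_covariance:
  assumes X: "free_poisson_process A \<phi> \<alpha> X" and st: "0 \<le> s" "s \<le> t"
  shows "\<phi> ((X s - (s * \<alpha>) *\<^sub>R id_blinfun) o\<^sub>L (X t - (t * \<alpha>) *\<^sub>R id_blinfun)) =
    complex_of_real (\<alpha>\<^sup>2 * s)"
proof -
  have X_in: "X u \<in> A" if "u \<ge> 0" for u
    using X that by (simp add: free_poisson_process_def)
  have X_0: "X 0 = 0"
    using X by (simp add: free_poisson_process_def)
  have \<kappa>: "free_cumulant1 \<phi> n (X v - X u) = complex_of_real ((v - u) * \<alpha> ^ n)"
    if "0 \<le> u" "u < v" "n \<ge> 1" for u v n
    using X that by (simp add: free_poisson_process_def)
  have mean: "\<phi> (X v) = of_real (v * \<alpha>)" if "v \<ge> 0" for v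
  proof (cases "v = 0")
    case True
    then show ?thesis using state_scaleR[of id_blinfun 0] by (simp add: X_0)
  next
    case False
    then show ?thesis using \<kappa>[of 0 v 1] that by (simp add: X_0 free_cumulant1_1 del: One_nat_def)
  qed
  have square: "\<phi> (X s o\<^sub>L X s) = of_real (s * \<alpha>\<^sup>2 + (s * \<alpha>)\<^sup>2)"
  proof (cases "s = 0")
    case True
    then show ?thesis using mean[of 0] by (simp add: X_0 blinfun_compose.zero_left)
  next
    case False
    then show ?thesis using \<kappa>[of 0 s 2] st mean[of s]
      by (simp add: X_0 free_cumulant1_2 power2_eq_square algebra_simps)
  qed
  have incr: "\<phi> (X s o\<^sub>L (X t - X s)) = of_real (s * \<alpha>) * of_real ((t - s) * \<alpha>)"
  proof (cases "s = 0 \<or> s = t")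
    case True
    then show ?thesis using mean[of 0]
      by (auto simp: X_0 blinfun_compose.zero_left blinfun_compose.zero_right)
  next
    case False
    \<comment> \<open>The first increment over these times is \<open>X s\<close> itself, since the process starts at \<open>0\<close>.\<close>
    define ts where "ts = [0, s, t]"
    have "freely_independent \<phi> {i. Suc i < length ts} (\<lambda>i. X (ts ! Suc i) - X (ts ! i))"
      using X False st unfolding free_poisson_process_def
      by (elim conjE allE[of _ ts]) (auto simp: ts_def)
    from freely_independent_state_compose[OF this, of 0 1] show ?thesis
      using st by (simp add: ts_def X_0 X_in state_diff mean left_diff_distrib)
  qed
  have "\<phi> (X s o\<^sub>L X t) = \<phi> (X s o\<^sub>L X s) + \<phi> (X s o\<^sub>L (X t - X s))"
    using st by (subst state_add[symmetric]) (simp_all add: X_in flip: blinfun_compose.add_right)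
  then have prod: "\<phi> (X s o\<^sub>L X t) = of_real (s * \<alpha>\<^sup>2 + s * \<alpha> * (t * \<alpha>))"
    unfolding square incr by (simp add: power2_eq_square algebra_simps)
  show ?thesis
    unfolding scaleC_of_real[symmetric]
    using st by (simp add: state_compose_centred X_in prod mean power2_eq_square algebra_simps)
qed

end

section \<open>The expansion of the free Poisson process\<close>

theorem theorem4p5:
  fixes A :: "('h::chilbert_space \<Rightarrow>\<^sub>L 'h) set"
    and \<phi> :: "('h \<Rightarrow>\<^sub>L 'h) \<Rightarrow> complex"
    and \<iota> :: "('h \<Rightarrow>\<^sub>L 'h) \<Rightarrow> 'l::chilbert_space"
    and X Xt :: "real \<Rightarrow> ('h \<Rightarrow>\<^sub>L 'h)"
    and T \<alpha> :: real
    and lam :: "nat \<Rightarrow> real"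
    and phi :: "nat \<Rightarrow> real \<Rightarrow> real"
    and Z :: "nat \<Rightarrow> 'l"
  assumes "wstar_prob_space A \<phi>"
    and "L2_completion A \<phi> \<iota>"
    and "T > 0"
    and "free_poisson_process A \<phi> \<alpha> X"
    and "\<And>t n. t \<ge> 0 \<Longrightarrow> n \<ge> 1 \<Longrightarrow> free_cumulant1 \<phi> n (X t) = complex_of_real (t * \<alpha> ^ n)"
    and "continuous_on {0..} (\<lambda>t. \<iota> (X t))"
    and Xt: "\<And>t. t \<ge> 0 \<Longrightarrow> Xt t = X t - (t * \<alpha>) *\<^sub>R id_blinfun"
    and lam: "\<And>n. n \<ge> 1 \<Longrightarrow> lam n = \<alpha>\<^sup>2 * T\<^sup>2 / ((real n - 1/2)\<^sup>2 * pi\<^sup>2)"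
    and phi: "\<And>n t. n \<ge> 1 \<Longrightarrow> phi n t = sqrt (2 / T) * sin ((real n - 1/2) * pi * t / T)"
    and Z: "\<And>i. i \<ge> 1 \<Longrightarrow> Z i = integral {0..T} (\<lambda>t. phi i t *\<^sub>R \<iota> (Xt t))"
  shows "(\<forall>t. 0 < t \<and> t \<le> T \<longrightarrow> (\<lambda>k. phi (Suc k) t *\<^sub>R Z (Suc k)) sums \<iota> (Xt t)) \<and>
         (\<forall>i\<ge>1. \<forall>j\<ge>1. phi_mult A \<phi> \<iota> (Z i) (Z j) = (if i = j then complex_of_real (lam i) else 0))"
proof -
  interpret L2: tracial_L2 A \<phi> \<iota>
    using assms(1,2) by unfold_locales (auto simp: wstar_prob_space_def von_neumann_algebra_def)
  have X_in: "X t \<in> A" and X_sa: "selfadjoint (X t)" if "t \<ge> 0" for t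
    using assms(4) that by (simp_all add: free_poisson_process_def)
  have Xt_in: "Xt t \<in> A" if "t \<ge> 0" for t
    using that by (simp add: Xt X_in)
  have Xt_sa: "selfadjoint (Xt t)" if "t \<ge> 0" for t
    using X_sa[OF that] by (simp add: Xt that is_adjoint_def blinfun.diff_left blinfun.scaleR_left
        cinner.diff_left cinner.diff_right cinner_scaleR_left cinner_scaleR_right)
  define f where "f t = \<iota> (Xt t)" for t
  have cov: "cinner (f s) (f t) = complex_of_real (\<alpha>\<^sup>2 * min s t)" if "0 \<le> s" "0 \<le> t" for s t
  proof -
    have ordered: "cinner (f u) (f v) = complex_of_real (\<alpha>\<^sup>2 * u)" if "0 \<le> u" "u \<le> v" for u v
    proof -
      have "cinner (f u) (f v) = \<phi> (Xt u o\<^sub>L Xt v)"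
        using that by (simp add: f_def L2.cinner_emb Xt_in adj_eqI[OF Xt_sa])
      then show ?thesis
        using L2.free_poisson_covariance[OF assms(4) that] that by (simp add: Xt)
    qed
    show ?thesis
    proof (cases "s \<le> t")
      case True
      then show ?thesis using ordered[of s t] that by simp
    next
      case False
      then show ?thesis using ordered[of t s] that cinner_commute[of "f s" "f t"] by simp
    qed
  qed
  have f_cont: "continuous_on {0..T} f"
  proof -
    have "continuous_on {0..T} (\<lambda>t. \<iota> (X t) - (t * \<alpha>) *\<^sub>R \<iota> id_blinfun)"
      by (intro continuous_intros continuous_on_subset[OF assms(6)]) auto
    then show ?thesis
      by (rule continuous_on_eq) (simp add: f_def Xt X_in L2.emb_diff L2.emb_scaleR)
  qed
  interpret KL: min_covariance f "\<alpha>\<^sup>2" T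
    using assms(3) f_cont cov by unfold_locales auto
  have phi_Suc: "phi (Suc k) = kl_basis T k" for k
    by (simp add: phi kl_basis_def kl_freq_def fun_eq_iff add.commute)
  have Z_Suc: "Z (Suc k) = KL.Z k" for k
    by (simp add: Z phi_Suc KL.Z_def f_def)
  have lam_Suc: "lam (Suc k) = \<alpha>\<^sup>2 / (kl_freq T k)\<^sup>2" for k
    by (simp add: lam kl_freq_def power_divide power_mult_distrib)
  have Z_sa: "L2.L2_selfadjoint (KL.Z k)" for k
    unfolding KL.Z_def
    by (intro L2.L2_selfadjoint_integral KL.integrable_Z L2.L2_selfadjoint_scaleR)
      (simp add: f_def L2.L2_selfadjoint_emb Xt_in Xt_sa)
  have "(\<lambda>k. phi (Suc k) t *\<^sub>R Z (Suc k)) sums \<iota> (Xt t)" if "0 < t" "t \<le> T" for t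
    using KL.karhunen_loeve[of t] that by (simp add: phi_Suc Z_Suc f_def)
  moreover have "phi_mult A \<phi> \<iota> (Z i) (Z j) = (if i = j then complex_of_real (lam i) else 0)"
    if ij: "i \<ge> 1" "j \<ge> 1" for i j
  proof -
    obtain k l where "i = Suc k" "j = Suc l"
      using ij by (metis One_nat_def Suc_le_D)
    then show ?thesis
      by (simp add: Z_Suc L2.phi_mult_eq_cinner[OF Z_sa] KL.cinner_Z lam_Suc)
  qed
  ultimately show ?thesis by blast
qed

end
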